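(* Let $A$ be a symmetric real $p\times p$ matrix, $B$ a symmetric positive definite real $p\times p$ matrix, and $1\le k<p$. Let $(V^\ast,\rho^\ast)$ be the solution of the trace ratio problem for $(A,B)$, with $(A-\rho^\ast B)V^\ast=V^\ast\Lambda^\ast$, and assume $\lambda_k(A-\rho^\ast B)>\lambda_{k+1}(A-\rho^\ast B)$. Let $k<j\le p$, let $\mathcal U$ be a $j$-dimensional subspace of $\mathbb R^p$, and let $(V,\rho)$ be the solution of the trace ratio problem projected onto $\mathcal U$. Let $[V\ \ Q\ \ U_\perp]$ be a $p\times p$ orthogonal matrix such that $U=[V\ \ Q]$ is an orthonormal basis of $\mathcal U$ (so $Q$ spans the orthogonal complement of $\operatorname{span}(V)$ in $\mathcal U$) and $U_\perp$ spans the orthogonal complement of $\mathcal U$ in $\mathbb R^p$. Let $\sin\theta=\|U_\perp^TV^\ast\|$, $\eta=\|U^T(A-\rho^\ast B)U_\perp\|$, $M=Q^T(A-\rho B)Q$, and assume $\operatorname{sep}(\Lambda^\ast,M)>0$. Then \[ \sin^2(V,V^\ast)\le\sin^2\theta+\left(\frac{\eta\,\sin\theta+(\rho^\ast-\rho)\,\|B\|\,(1+\sin\theta)}{\operatorname{sep}(\Lambda^\ast,M)}\right)^2 . \]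
   Context: The trace ratio problem for $(A,B)$ is $\max_{V\in\mathbb R^{p\times k},\,V^TV=I_k}\rho(V)$, with $\rho(V)=\operatorname{tr}(V^TAV)/\operatorname{tr}(V^TBV)$; its solution $(V^\ast,\rho^\ast)$ consists of a maximizer $V^\ast$ ($p\times k$, orthonormal columns) and the maximum value $\rho^\ast$. It is known that the columns of $V^\ast$ form an orthonormal basis of the eigenspace of $A-\rho^\ast B$ associated with its $k$ largest eigenvalues, so $\Lambda^\ast=(V^\ast)^T(A-\rho^\ast B)V^\ast$. Eigenvalues of a symmetric $p\times p$ matrix $S$ are ordered $\lambda_1(S)\ge\dots\ge\lambda_p(S)$. The solution $(V,\rho)$ of the trace ratio problem projected onto $\mathcal U$ consists of a maximizer $V$ and the maximum value $\rho$ of $\rho(V)$ over all $p\times k$ matrices $V$ with orthonormal columns lying in $\mathcal U$. $\|\cdot\|$ is the spectral norm (norms of empty matrices are $0$). For a $p\times m$ matrix $W$ with orthonormal columns, $m\ge k$, $\sin(W,V^\ast)=\|W_\perp^TV^\ast\|$, where the columns of $W_\perp$ form an orthonormal basis of the orthogonal complement of $\operatorname{span}(W)$; thus $\sin\theta=\sin(U,V^\ast)$. For a $k\times k$ matrix $S$ and an $m\times m$ matrix $T$, $\operatorname{sep}(S,T)=\min_{\|P\|=1}\|PS-TP\|$, the minimum being over real $m\times k$ matrices $P$ of unit spectral norm. *)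

theory Defs
  imports "Jordan_Normal_Form.VS_Connect" "Jordan_Normal_Form.Char_Poly"
begin

definition subspace_of_dim :: "nat \<Rightarrow> nat \<Rightarrow> real vec set \<Rightarrow> bool" where
  "subspace_of_dim p j S \<longleftrightarrow>
     VectorSpace.subspace class_ring S (module_vec TYPE(real) p) \<and>
     vectorspace.dim class_ring ((module_vec TYPE(real) p)\<lparr>carrier := S\<rparr>) = j"

definition col_span :: "real mat \<Rightarrow> real vec set" where
  "col_span W = vec_space.col_space (dim_row W) W"

definition ortho_compl :: "nat \<Rightarrow> real vec set \<Rightarrow> real vec set" where
  "ortho_compl p S = vec_module.orthogonal_complement p S"

definition orthonormal_cols :: "real mat \<Rightarrow> bool" where
  "orthonormal_cols W \<longleftrightarrow> W\<^sup>T * W = 1\<^sub>m (dim_col W)"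

definition orthonormal_basis_of :: "nat \<Rightarrow> real vec set \<Rightarrow> real mat \<Rightarrow> bool" where
  "orthonormal_basis_of p S W \<longleftrightarrow> dim_row W = p \<and> orthonormal_cols W \<and> col_span W = S"

definition pos_def :: "nat \<Rightarrow> real mat \<Rightarrow> bool" where
  "pos_def p B \<longleftrightarrow> B \<in> carrier_mat p p \<and> B\<^sup>T = B \<and>
     (\<forall>x \<in> carrier_vec p. x \<noteq> 0\<^sub>v p \<longrightarrow> 0 < x \<bullet> (B *\<^sub>v x))"

definition mat_trace :: "real mat \<Rightarrow> real" where
  "mat_trace S = (\<Sum>i<dim_row S. S $$ (i, i))"

(* Indices start at 1, eigenvalues are repeated according to multiplicity. *)
definition eigenvalue_desc :: "nat \<Rightarrow> real mat \<Rightarrow> real" where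
  "eigenvalue_desc i S = rev (sorted_list_of_multiset (proots (char_poly S))) ! (i - 1)"

definition euclid_norm :: "real vec \<Rightarrow> real" where
  "euclid_norm x = sqrt (x \<bullet> x)"

(* The closed unit ball, rather than the unit sphere, gives norm 0 to a matrix without columns. *)
definition spectral_norm :: "real mat \<Rightarrow> real" where
  "spectral_norm S =
     Sup {euclid_norm (S *\<^sub>v x) | x. x \<in> carrier_vec (dim_col S) \<and> euclid_norm x \<le> 1}"

(* The infimum is attained by compactness whenever S and T are square of positive size. *)
definition sep :: "real mat \<Rightarrow> real mat \<Rightarrow> real" where
  "sep S T =
     Inf {spectral_norm (P * S - T * P) | P.
            P \<in> carrier_mat (dim_row T) (dim_row S) \<and> spectral_norm P = 1}"

(* Two choices of the basis differ by an orthogonal factor on the right, so the norm in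
   sin_between does not depend on the choice. *)
definition perp_basis :: "real mat \<Rightarrow> real mat" where
  "perp_basis W =
     (SOME Wp. orthonormal_basis_of (dim_row W) (ortho_compl (dim_row W) (col_span W)) Wp)"

definition sin_between :: "real mat \<Rightarrow> real mat \<Rightarrow> real" where
  "sin_between W X = spectral_norm ((perp_basis W)\<^sup>T * X)"

definition trace_ratio :: "real mat \<Rightarrow> real mat \<Rightarrow> real mat \<Rightarrow> real" where
  "trace_ratio A B V = mat_trace (V\<^sup>T * A * V) / mat_trace (V\<^sup>T * B * V)"

definition projected_trace_ratio_solution ::
    "nat \<Rightarrow> nat \<Rightarrow> real mat \<Rightarrow> real mat \<Rightarrow> real vec set \<Rightarrow> real mat \<Rightarrow> real \<Rightarrow> bool" where
  "projected_trace_ratio_solution p k A B S V \<rho> \<longleftrightarrow>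
     (let F = {W \<in> carrier_mat p k. orthonormal_cols W \<and> set (cols W) \<subseteq> S}
      in V \<in> F \<and> \<rho> = trace_ratio A B V \<and> (\<forall>W \<in> F. trace_ratio A B W \<le> \<rho>))"

definition trace_ratio_solution ::
    "nat \<Rightarrow> nat \<Rightarrow> real mat \<Rightarrow> real mat \<Rightarrow> real mat \<Rightarrow> real \<Rightarrow> bool" where
  "trace_ratio_solution p k A B V \<rho> \<longleftrightarrow>
     (let F = {W \<in> carrier_mat p k. orthonormal_cols W}
      in V \<in> F \<and> \<rho> = trace_ratio A B V \<and> (\<forall>W \<in> F. trace_ratio A B W \<le> \<rho>))"

end

theory Submission
  imports Defs "HOL-Analysis.L2_Norm"
begin

text \<open>Write \<open>P = Q\<^sup>T V*\<close> and \<open>G = U\<^sub>\<bottom>\<^sup>T V*\<close>. Since \<open>[Q U\<^sub>\<bottom>]\<close> is an orthonormal basis of the complement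
  of \<open>V\<close>, \<open>sin\<^sup>2(V, V* )\<close> is at most \<open>\<parallel>P\<parallel>\<^sup>2 + \<parallel>G\<parallel>\<^sup>2\<close>. First-order optimality of \<open>V\<close> in \<open>\<U>\<close> gives
  \<open>Q\<^sup>T (A - \<rho> B) V = 0\<close>, so multiplying \<open>(A - \<rho>* B) V* = V* \<Lambda>*\<close> by \<open>Q\<^sup>T\<close> and inserting
  \<open>V* = U U\<^sup>T V* + U\<^sub>\<bottom> G\<close> yields
  \<open>P \<Lambda>* - M P = Q\<^sup>T (A - \<rho>* B) U\<^sub>\<bottom> G - (\<rho>* - \<rho>) Q\<^sup>T B U U\<^sup>T V*\<close>.
  The norm of the right-hand side is at most \<open>\<eta> sin \<theta> + (\<rho>* - \<rho>) \<parallel>B\<parallel>\<close>, that of the left-hand side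
  at least \<open>sep(\<Lambda>*, M) \<parallel>P\<parallel>\<close>.\<close>

section \<open>Euclidean norm of vectors\<close>

lemma euclid_norm_L2: "euclid_norm x = L2_set (($) x) {0..<dim_vec x}"
  by (simp add: euclid_norm_def L2_set_def scalar_prod_def power2_eq_square)

lemma euclid_norm_nonneg [simp]: "0 \<le> euclid_norm x"
  by (simp add: euclid_norm_L2 L2_set_nonneg)

lemma euclid_norm_sq: "(euclid_norm x)\<^sup>2 = x \<bullet> x"
  by (simp add: euclid_norm_def scalar_prod_def sum_nonneg)

lemma euclid_norm_zero [simp]: "euclid_norm (0\<^sub>v n) = 0"
  by (simp add: euclid_norm_def)

lemma euclid_norm_eq_0: "x \<in> carrier_vec n \<Longrightarrow> euclid_norm x = 0 \<longleftrightarrow> x = 0\<^sub>v n"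
  by (auto simp: euclid_norm_L2 L2_set_eq_0_iff)

lemma euclid_norm_smult: "euclid_norm (a \<cdot>\<^sub>v x) = \<bar>a\<bar> * euclid_norm x"
proof -
  have "(a \<cdot>\<^sub>v x) \<bullet> (a \<cdot>\<^sub>v x) = a\<^sup>2 * (x \<bullet> x)"
    by (simp add: power2_eq_square)
  then show ?thesis by (simp add: euclid_norm_def real_sqrt_mult)
qed

lemma euclid_norm_triangle:
  assumes "x \<in> carrier_vec n" "y \<in> carrier_vec n"
  shows "euclid_norm (x + y) \<le> euclid_norm x + euclid_norm y"
proof -
  have "euclid_norm (x + y) = L2_set (\<lambda>i. x $ i + y $ i) {0..<n}"
    unfolding euclid_norm_L2 using assms by (auto intro!: L2_set_cong)
  also have "\<dots> \<le> euclid_norm x + euclid_norm y"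
    unfolding euclid_norm_L2 using assms L2_set_triangle_ineq[of "($) x" "($) y" "{0..<n}"] by auto
  finally show ?thesis .
qed

lemma scalar_prod_le_euclid_norm:
  assumes "x \<in> carrier_vec n" "y \<in> carrier_vec n"
  shows "\<bar>x \<bullet> y\<bar> \<le> euclid_norm x * euclid_norm y"
proof -
  have "\<bar>x \<bullet> y\<bar> \<le> (\<Sum>i\<in>{0..<n}. \<bar>x $ i\<bar> * \<bar>y $ i\<bar>)"
    unfolding scalar_prod_def using assms by (auto simp flip: abs_mult)
  also have "\<dots> \<le> euclid_norm x * euclid_norm y"
    unfolding euclid_norm_L2 using assms L2_set_mult_ineq[of "($) x" "($) y" "{0..<n}"] by auto
  finally show ?thesis .
qed

section \<open>Spectral norm and \<open>sep\<close>\<close>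

lemma spectral_norm_bdd:
  "bdd_above {euclid_norm (S *\<^sub>v x) | x. x \<in> carrier_vec (dim_col S) \<and> euclid_norm x \<le> 1}"
proof (rule bdd_aboveI)
  fix t assume "t \<in> {euclid_norm (S *\<^sub>v x) | x. x \<in> carrier_vec (dim_col S) \<and> euclid_norm x \<le> 1}"
  then obtain x where x: "x \<in> carrier_vec (dim_col S)" "euclid_norm x \<le> 1"
    and t: "t = euclid_norm (S *\<^sub>v x)" by auto
  \<comment> \<open>By Cauchy--Schwarz each entry of \<open>S *\<^sub>v x\<close> is at most the
    norm of its row, which makes the Frobenius norm of \<open>S\<close> an upper bound.\<close>
  have "\<bar>row S i \<bullet> x\<bar> \<le> euclid_norm (row S i)" if "i < dim_row S" for i
    using scalar_prod_le_euclid_norm[of "row S i" "dim_col S" x] x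
      mult_left_mono[OF x(2), of "euclid_norm (row S i)"] by simp
  then have "L2_set (\<lambda>i. \<bar>row S i \<bullet> x\<bar>) {0..<dim_row S}
      \<le> L2_set (\<lambda>i. euclid_norm (row S i)) {0..<dim_row S}"
    by (intro L2_set_mono) auto
  moreover have "L2_set (\<lambda>i. \<bar>row S i \<bullet> x\<bar>) {0..<dim_row S} = t"
    unfolding t euclid_norm_L2 L2_set_def by simp
  ultimately show "t \<le> L2_set (\<lambda>i. euclid_norm (row S i)) {0..<dim_row S}" by simp
qed

text \<open>The sign condition on \<open>c\<close> matters when \<open>S\<close> has no columns: the
  first premise then holds for every \<open>c\<close>, whereas the norm is 0.\<close>

lemma spectral_norm_leI:
  assumes "\<And>x. x \<in> carrier_vec (dim_col S) \<Longrightarrow> euclid_norm (S *\<^sub>v x) \<le> c * euclid_norm x"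
    and "0 \<le> c"
  shows "spectral_norm S \<le> c"
  unfolding spectral_norm_def
proof (rule cSup_least)
  show "{euclid_norm (S *\<^sub>v x) | x. x \<in> carrier_vec (dim_col S) \<and> euclid_norm x \<le> 1} \<noteq> {}"
    by (auto intro!: exI[of _ "0\<^sub>v (dim_col S)"])
next
  fix t assume "t \<in> {euclid_norm (S *\<^sub>v x) | x. x \<in> carrier_vec (dim_col S) \<and> euclid_norm x \<le> 1}"
  then obtain x where x: "x \<in> carrier_vec (dim_col S)" "euclid_norm x \<le> 1"
    and t: "t = euclid_norm (S *\<^sub>v x)" by auto
  show "t \<le> c"
    using assms(1)[OF x(1)] mult_left_mono[OF x(2) assms(2)] t by simp
qed

lemma spectral_norm_upper:
  "x \<in> carrier_vec (dim_col S) \<Longrightarrow> euclid_norm x \<le> 1 \<Longrightarrow> euclid_norm (S *\<^sub>v x) \<le> spectral_norm S"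
  unfolding spectral_norm_def by (rule cSup_upper[OF _ spectral_norm_bdd]) auto

lemma spectral_norm_nonneg [simp]: "0 \<le> spectral_norm S"
  using order_trans[OF euclid_norm_nonneg spectral_norm_upper[of "0\<^sub>v (dim_col S)" S]] by simp

lemma euclid_norm_mult_mat_vec:
  assumes S: "S \<in> carrier_mat m n" and x: "x \<in> carrier_vec n"
  shows "euclid_norm (S *\<^sub>v x) \<le> spectral_norm S * euclid_norm x"
proof (cases "euclid_norm x = 0")
  case True
  then have "S *\<^sub>v x = 0\<^sub>v m" using S x euclid_norm_eq_0[OF x] by auto
  then show ?thesis using True by simp
next
  case False
  then have pos: "0 < euclid_norm x" using euclid_norm_nonneg[of x] by linarith
  let ?y = "(1 / euclid_norm x) \<cdot>\<^sub>v x"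
  have "euclid_norm (S *\<^sub>v ?y) \<le> spectral_norm S"
    using S x pos by (intro spectral_norm_upper) (auto simp: euclid_norm_smult)
  moreover have "S *\<^sub>v ?y = (1 / euclid_norm x) \<cdot>\<^sub>v (S *\<^sub>v x)"
    by (rule mult_mat_vec[OF S x])
  ultimately show ?thesis using pos by (simp add: euclid_norm_smult field_simps)
qed

lemma spectral_norm_mult:
  fixes S T :: "real mat"
  assumes S: "S \<in> carrier_mat m n" and T: "T \<in> carrier_mat n l"
  shows "spectral_norm (S * T) \<le> spectral_norm S * spectral_norm T"
proof (rule spectral_norm_leI)
  fix x :: "real vec" assume "x \<in> carrier_vec (dim_col (S * T))"
  then have x: "x \<in> carrier_vec l" using T by simp
  have "euclid_norm ((S * T) *\<^sub>v x) = euclid_norm (S *\<^sub>v (T *\<^sub>v x))"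
    using S T x by simp
  also have "\<dots> \<le> spectral_norm S * euclid_norm (T *\<^sub>v x)"
    using S T x by (intro euclid_norm_mult_mat_vec) auto
  also have "\<dots> \<le> spectral_norm S * (spectral_norm T * euclid_norm x)"
    using euclid_norm_mult_mat_vec[OF T x] by (rule mult_left_mono) simp
  finally show "euclid_norm ((S * T) *\<^sub>v x) \<le> spectral_norm S * spectral_norm T * euclid_norm x"
    by (simp add: mult.assoc)
qed simp

lemma spectral_norm_add:
  fixes S T :: "real mat"
  assumes S: "S \<in> carrier_mat m n" and T: "T \<in> carrier_mat m n"
  shows "spectral_norm (S + T) \<le> spectral_norm S + spectral_norm T"
proof (rule spectral_norm_leI)
  fix x :: "real vec" assume "x \<in> carrier_vec (dim_col (S + T))"
  then have x: "x \<in> carrier_vec n" using T by simp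
  have "(S + T) *\<^sub>v x = S *\<^sub>v x + T *\<^sub>v x"
    by (rule add_mult_distrib_mat_vec[OF S T x])
  then show "euclid_norm ((S + T) *\<^sub>v x) \<le> (spectral_norm S + spectral_norm T) * euclid_norm x"
    using euclid_norm_triangle[of "S *\<^sub>v x" m "T *\<^sub>v x"] S T x
      euclid_norm_mult_mat_vec[OF S x] euclid_norm_mult_mat_vec[OF T x]
    by (simp add: distrib_right)
qed simp

lemma smult_mat_mult_vec:
  fixes S :: "real mat"
  assumes "S \<in> carrier_mat m n" "x \<in> carrier_vec n"
  shows "(a \<cdot>\<^sub>m S) *\<^sub>v x = a \<cdot>\<^sub>v (S *\<^sub>v x)"
  using assms by (intro eq_vecI) (auto simp: scalar_prod_def sum_distrib_left mult.assoc)

lemma spectral_norm_smult_le: "spectral_norm (a \<cdot>\<^sub>m S) \<le> \<bar>a\<bar> * spectral_norm S"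
proof (rule spectral_norm_leI)
  fix x :: "real vec" assume "x \<in> carrier_vec (dim_col (a \<cdot>\<^sub>m S))"
  then have x: "x \<in> carrier_vec (dim_col S)" by simp
  have "(a \<cdot>\<^sub>m S) *\<^sub>v x = a \<cdot>\<^sub>v (S *\<^sub>v x)"
    using x by (intro smult_mat_mult_vec[of _ "dim_row S" "dim_col S"]) auto
  then show "euclid_norm ((a \<cdot>\<^sub>m S) *\<^sub>v x) \<le> \<bar>a\<bar> * spectral_norm S * euclid_norm x"
    using euclid_norm_mult_mat_vec[of S "dim_row S" "dim_col S" x] x
    by (simp add: euclid_norm_smult mult.assoc mult_left_mono)
qed simp

lemma spectral_norm_smult: "spectral_norm (a \<cdot>\<^sub>m S) = \<bar>a\<bar> * spectral_norm S"
proof (cases "a = 0")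
  case True
  then show ?thesis
    using spectral_norm_smult_le[of a S] spectral_norm_nonneg[of "a \<cdot>\<^sub>m S"]
    by (intro antisym) (auto simp del: spectral_norm_nonneg)
next
  case False
  \<comment> \<open>Scaling back by \<open>1 / a\<close> turns the upper estimate for
    \<open>a \<cdot>\<^sub>m S\<close> into the lower one.\<close>
  then have "(1 / a) \<cdot>\<^sub>m (a \<cdot>\<^sub>m S) = S" by (intro eq_matI) auto
  then have "spectral_norm S \<le> \<bar>1 / a\<bar> * spectral_norm (a \<cdot>\<^sub>m S)"
    by (metis spectral_norm_smult_le)
  with False have "\<bar>a\<bar> * spectral_norm S \<le> spectral_norm (a \<cdot>\<^sub>m S)"
    by (simp add: field_simps)
  with spectral_norm_smult_le show ?thesis by (rule antisym)
qed

text \<open>Both sides are homogeneous in \<open>P\<close>, so normalising is enough: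
  \<open>P\<close> divided by its norm takes part in the infimum that defines \<open>sep\<close>,
  and that infimum is over a set bounded below by 0.\<close>

lemma sep_mult_le:
  assumes S: "S \<in> carrier_mat k k" and T: "T \<in> carrier_mat m m" and P: "P \<in> carrier_mat m k"
  shows "sep S T * spectral_norm P \<le> spectral_norm (P * S - T * P)"
proof (cases "spectral_norm P = 0")
  case True
  then show ?thesis by simp
next
  case False
  let ?a = "1 / spectral_norm P"
  have pos: "0 < spectral_norm P" using False spectral_norm_nonneg[of P] by linarith
  have "sep S T \<le> spectral_norm ((?a \<cdot>\<^sub>m P) * S - T * (?a \<cdot>\<^sub>m P))"
    unfolding sep_def
  proof (rule cInf_lower)
    show "bdd_below {spectral_norm (P * S - T * P) | P.
            P \<in> carrier_mat (dim_row T) (dim_row S) \<and> spectral_norm P = 1}"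
      by (rule bdd_belowI[of _ 0]) auto
  qed (use S T P pos in \<open>auto simp: spectral_norm_smult intro!: exI[of _ "?a \<cdot>\<^sub>m P"]\<close>)
  also have "(?a \<cdot>\<^sub>m P) * S - T * (?a \<cdot>\<^sub>m P) = ?a \<cdot>\<^sub>m (P * S) - ?a \<cdot>\<^sub>m (T * P)"
    using mult_smult_assoc_mat[OF P S] mult_smult_distrib[OF T P] by simp
  also have "\<dots> = ?a \<cdot>\<^sub>m (P * S - T * P)"
    using S T P by (intro eq_matI) (auto simp: diff_divide_distrib)
  finally show ?thesis using pos by (simp add: spectral_norm_smult field_simps)
qed

section \<open>Matrices with orthonormal columns\<close>

lemma euclid_norm_orthonormal:
  assumes W: "W \<in> carrier_mat n m" "orthonormal_cols W" and x: "x \<in> carrier_vec m"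
  shows "euclid_norm (W *\<^sub>v x) = euclid_norm x"
proof -
  have "(W *\<^sub>v x) \<bullet> (W *\<^sub>v x) = x \<bullet> (W\<^sup>T *\<^sub>v (W *\<^sub>v x))"
    using transpose_vec_mult_scalar[OF W(1) x, of "W *\<^sub>v x"] W x
    by (simp add: comm_scalar_prod[of _ m])
  also have "W\<^sup>T *\<^sub>v (W *\<^sub>v x) = (W\<^sup>T * W) *\<^sub>v x"
    using W x by simp
  also have "\<dots> = x" using W x by (simp add: orthonormal_cols_def)
  finally show ?thesis by (simp add: euclid_norm_def)
qed

text \<open>Bessel's inequality, from Cauchy--Schwarz applied to \<open>x\<close> and \<open>W W\<^sup>T x\<close>.\<close>
lemma euclid_norm_orthonormal_transpose:
  assumes W: "W \<in> carrier_mat n m" "orthonormal_cols W" and x: "x \<in> carrier_vec n"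
  shows "euclid_norm (W\<^sup>T *\<^sub>v x) \<le> euclid_norm x"
proof -
  let ?y = "W\<^sup>T *\<^sub>v x"
  have y: "?y \<in> carrier_vec m" using W x by simp
  have "(euclid_norm ?y)\<^sup>2 = (W *\<^sub>v ?y) \<bullet> x"
    unfolding euclid_norm_sq using transpose_vec_mult_scalar[OF W(1) y x] W x y
    by (simp add: comm_scalar_prod[of _ n])
  also have "\<dots> \<le> euclid_norm ?y * euclid_norm x"
    using scalar_prod_le_euclid_norm[of "W *\<^sub>v ?y" n x] W x y
    by (simp add: euclid_norm_orthonormal[OF W y])
  finally have "euclid_norm ?y * euclid_norm ?y \<le> euclid_norm ?y * euclid_norm x"
    by (simp add: power2_eq_square)
  then show ?thesis
    using euclid_norm_nonneg[of ?y] euclid_norm_nonneg[of x]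
    by (cases "euclid_norm ?y = 0") (auto simp: mult_le_cancel_left)
qed

lemma spectral_norm_orthonormal_le:
  assumes "W \<in> carrier_mat n m" "orthonormal_cols W"
  shows "spectral_norm W \<le> 1" "spectral_norm W\<^sup>T \<le> 1"
  using assms euclid_norm_orthonormal[OF assms] euclid_norm_orthonormal_transpose[OF assms]
  by (auto intro!: spectral_norm_leI)

section \<open>Column spans, block matrices and orthogonal complements\<close>

lemma sum_atLeastLessThan_add:
  fixes f :: "nat \<Rightarrow> real"
  shows "(\<Sum>i\<in>{0..<a + b}. f i) = (\<Sum>i\<in>{0..<a}. f i) + (\<Sum>i\<in>{0..<b}. f (a + i))"
  using sum.atLeastLessThan_concat[of 0 a "a + b" f] sum.shift_bounds_nat_ivl[of f 0 a b]
  by (simp add: add.commute)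

lemma col_span_eq:
  assumes "W \<in> carrier_mat n m"
  shows "col_span W = {W *\<^sub>v x | x. x \<in> carrier_vec m}"
proof -
  interpret vec_space "TYPE(real)" n .
  have "col_space W = {y \<in> carrier_vec n. \<exists>x\<in>carrier_vec m. W *\<^sub>v x = y}"
    using col_space_eq[OF assms] assms by simp
  then show ?thesis using assms by (auto simp: col_span_def)
qed

lemma col_span_combination:
  fixes W :: "real mat"
  assumes W: "W \<in> carrier_mat n m" and v: "v \<in> col_span W" "w \<in> col_span W"
  shows "a \<cdot>\<^sub>v v + b \<cdot>\<^sub>v w \<in> col_span W"
proof -
  obtain x y where x: "x \<in> carrier_vec m" "v = W *\<^sub>v x" and y: "y \<in> carrier_vec m" "w = W *\<^sub>v y"
    using v unfolding col_span_eq[OF W] by auto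
  have "W *\<^sub>v (a \<cdot>\<^sub>v x + b \<cdot>\<^sub>v y) = a \<cdot>\<^sub>v v + b \<cdot>\<^sub>v w"
    using x y mult_add_distrib_mat_vec[OF W, of "a \<cdot>\<^sub>v x" "b \<cdot>\<^sub>v y"] mult_mat_vec[OF W] by simp
  then show ?thesis unfolding col_span_eq[OF W] using x y
    by (auto intro!: exI[of _ "a \<cdot>\<^sub>v x + b \<cdot>\<^sub>v y"])
qed

lemma cols_subset_col_span:
  assumes "W \<in> carrier_mat n m"
  shows "set (cols W) \<subseteq> col_span W"
proof -
  interpret vec_space "TYPE(real)" n .
  show ?thesis
    using in_own_span[of "set (cols W)"] assms cols_dim[of W]
    by (auto simp: col_span_def col_space_def)
qed

lemma orthonormal_cols_iff:
  assumes W: "W \<in> carrier_mat n m"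
  shows "orthonormal_cols W \<longleftrightarrow> (\<forall>r<m. \<forall>c<m. col W r \<bullet> col W c = (if r = c then 1 else 0))"
proof
  assume "orthonormal_cols W"
  then have "(W\<^sup>T * W) $$ (r, c) = 1\<^sub>m m $$ (r, c)" for r c
    using W by (simp add: orthonormal_cols_def)
  moreover have "(W\<^sup>T * W) $$ (r, c) = col W r \<bullet> col W c" if "r < m" "c < m" for r c
    using W that by simp
  ultimately show "\<forall>r<m. \<forall>c<m. col W r \<bullet> col W c = (if r = c then 1 else 0)"
    by simp
next
  assume "\<forall>r<m. \<forall>c<m. col W r \<bullet> col W c = (if r = c then 1 else 0)"
  then show "orthonormal_cols W"
    unfolding orthonormal_cols_def using W by (intro eq_matI) auto
qed

text \<open>Here \<open>A\<close> and \<open>B\<close> are any two column blocks, with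
  \<open>W = [A B]\<close>. The instances used later are \<open>[V Q]\<close>, \<open>[V N]\<close>,
  \<open>[U Uperp]\<close> and \<open>[Q Uperp]\<close>.\<close>

context
  fixes n a b :: nat and A B W :: "real mat"
  assumes A: "A \<in> carrier_mat n a" and B: "B \<in> carrier_mat n b"
    and W_def: "W = mat_of_cols n (cols A @ cols B)"
begin

lemma hcat_carrier: "W \<in> carrier_mat n (a + b)"
  unfolding W_def using A B by (intro carrier_matI) auto

lemma hcat_col: "c < a \<Longrightarrow> col W c = col A c" "c < b \<Longrightarrow> col W (a + c) = col B c"
  using A B unfolding W_def by (auto simp: col_mat_of_cols nth_append)

lemma hcat_index:
  assumes "i < n"
  shows "c < a \<Longrightarrow> W $$ (i, c) = A $$ (i, c)" "c < b \<Longrightarrow> W $$ (i, a + c) = B $$ (i, c)"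
  using assms A B unfolding W_def by (auto simp: mat_of_cols_index nth_append)

text \<open>For an orthogonal \<open>W\<close> the left side is the identity, which is thereby
  resolved into the projections onto the spans of the two blocks.\<close>

lemma hcat_mult_transpose: "W * W\<^sup>T = A * A\<^sup>T + B * B\<^sup>T"
  using A B hcat_carrier
  by (intro eq_matI) (auto simp: scalar_prod_def sum_atLeastLessThan_add hcat_index)

lemma hcat_orthonormal:
  assumes "orthonormal_cols W"
  shows "orthonormal_cols A" "orthonormal_cols B" "A\<^sup>T * B = 0\<^sub>m a b"
proof -
  have *: "col W r \<bullet> col W c = (if r = c then 1 else 0)" if "r < a + b" "c < a + b" for r c
    using assms that unfolding orthonormal_cols_iff[OF hcat_carrier] by blast
  show "orthonormal_cols A" unfolding orthonormal_cols_def
    using A *[of r c for r c] by (intro eq_matI) (auto simp flip: hcat_col(1))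
  show "orthonormal_cols B" unfolding orthonormal_cols_def
    using B *[of "a + r" "a + c" for r c] by (intro eq_matI) (auto simp flip: hcat_col(2))
  show "A\<^sup>T * B = 0\<^sub>m a b"
    using A B *[of r "a + c" for r c] by (intro eq_matI) (auto simp flip: hcat_col)
qed

text \<open>Pythagoras: the entries of \<open>W\<^sup>T *\<^sub>v x\<close> are those of
  \<open>A\<^sup>T *\<^sub>v x\<close> followed by those of
  \<open>B\<^sup>T *\<^sub>v x\<close>.\<close>

lemma hcat_transpose_norm:
  "(euclid_norm (W\<^sup>T *\<^sub>v x))\<^sup>2 = (euclid_norm (A\<^sup>T *\<^sub>v x))\<^sup>2 + (euclid_norm (B\<^sup>T *\<^sub>v x))\<^sup>2"
proof -
  have "(euclid_norm (S\<^sup>T *\<^sub>v x))\<^sup>2 = (\<Sum>i\<in>{0..<m}. (col S i \<bullet> x)\<^sup>2)" if "S \<in> carrier_mat n m" for S m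
    unfolding euclid_norm_sq scalar_prod_def[of "S\<^sup>T *\<^sub>v x"]
    using that by (auto intro!: sum.cong simp: power2_eq_square)
  from this[OF A] this[OF B] this[OF hcat_carrier] show ?thesis
    by (simp add: sum_atLeastLessThan_add hcat_col)
qed

end

text \<open>If \<open>[V N]\<close> is orthogonal, then \<open>W = N N\<^sup>T W\<close> for every basis matrix \<open>W\<close> of the orthogonal
  complement of \<open>V\<close>, so any choice made by \<open>perp_basis\<close> is dominated by \<open>N\<close>.\<close>
lemma perp_basis_norm_le:
  fixes V N :: "real mat"
  assumes V: "V \<in> carrier_mat n a" and N: "N \<in> carrier_mat n b"
    and resolution: "V * V\<^sup>T + N * N\<^sup>T = 1\<^sub>m n"
    and N_on: "orthonormal_cols N" and VN: "V\<^sup>T * N = 0\<^sub>m a b"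
  shows "dim_row (perp_basis V) = n"
    and "x \<in> carrier_vec n \<Longrightarrow>
      euclid_norm ((perp_basis V)\<^sup>T *\<^sub>v x) \<le> euclid_norm (N\<^sup>T *\<^sub>v x)"
proof -
  let ?C = "ortho_compl n (col_span V)"
  let ?W = "perp_basis V"
  have split: "y = V *\<^sub>v (V\<^sup>T *\<^sub>v y) + N *\<^sub>v (N\<^sup>T *\<^sub>v y)" if y: "y \<in> carrier_vec n" for y
  proof -
    have "y = (V * V\<^sup>T + N * N\<^sup>T) *\<^sub>v y" using y by (simp add: resolution)
    also have "\<dots> = (V * V\<^sup>T) *\<^sub>v y + (N * N\<^sup>T) *\<^sub>v y"
      using V N y by (intro add_mult_distrib_mat_vec) auto
    finally show ?thesis using V N y by simp
  qed
  have perp_iff: "y \<in> ?C \<longleftrightarrow> V\<^sup>T *\<^sub>v y = 0\<^sub>v a" if y: "y \<in> carrier_vec n" for y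
  proof
    assume y': "y \<in> ?C"
    \<comment> \<open>Testing the orthogonality of \<open>y\<close> against the vector
      \<open>V *\<^sub>v ?z\<close> shows that \<open>?z\<close> has norm 0.\<close>
    let ?z = "V\<^sup>T *\<^sub>v y"
    have z: "?z \<in> carrier_vec a" using V y by simp
    have "V *\<^sub>v ?z \<in> col_span V" using z by (auto simp: col_span_eq[OF V])
    then have "y \<bullet> (V *\<^sub>v ?z) = 0"
      using y' by (auto simp: ortho_compl_def vec_module.orthogonal_complement_def)
    then have "?z \<bullet> ?z = 0"
      using transpose_vec_mult_scalar[OF V z y] by simp
    then show "?z = 0\<^sub>v a" using euclid_norm_eq_0[OF z] by (simp add: euclid_norm_def)
  next
    assume "V\<^sup>T *\<^sub>v y = 0\<^sub>v a"
    then have "y \<bullet> (V *\<^sub>v z) = 0" if "z \<in> carrier_vec a" for z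
      using transpose_vec_mult_scalar[OF V that y] that by simp
    then show "y \<in> ?C"
      using y by (auto simp: ortho_compl_def vec_module.orthogonal_complement_def col_span_eq[OF V])
  qed
  have C_carrier: "?C \<subseteq> carrier_vec n"
    by (auto simp: ortho_compl_def vec_module.orthogonal_complement_def)
  have "col_span N = ?C"
  proof
    have "V\<^sup>T *\<^sub>v (N *\<^sub>v y) = 0\<^sub>v a" if "y \<in> carrier_vec b" for y
    proof -
      have "V\<^sup>T *\<^sub>v (N *\<^sub>v y) = (V\<^sup>T * N) *\<^sub>v y" using V N that by simp
      also have "\<dots> = 0\<^sub>v a" using that by (auto simp: VN)
      finally show ?thesis .
    qed
    then show "col_span N \<subseteq> ?C" using N by (auto simp: col_span_eq[OF N] perp_iff)
  next
    show "?C \<subseteq> col_span N"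
    proof
      fix y assume y: "y \<in> ?C"
      then have yc: "y \<in> carrier_vec n" using C_carrier by auto
      have "V *\<^sub>v 0\<^sub>v a = 0\<^sub>v n" using V by auto
      then have "y = N *\<^sub>v (N\<^sup>T *\<^sub>v y)"
        using split[OF yc] y V N yc by (simp add: perp_iff)
      then show "y \<in> col_span N" using N yc unfolding col_span_eq[OF N]
        by (auto intro!: exI[of _ "N\<^sup>T *\<^sub>v y"])
    qed
  qed
  \<comment> \<open>\<open>N\<close> witnesses that an orthonormal basis of the complement exists,
    so the choice in \<open>perp_basis\<close> yields one.\<close>
  then have "orthonormal_basis_of n ?C N"
    using N N_on by (simp add: orthonormal_basis_of_def)
  then have W: "orthonormal_basis_of n ?C ?W"
    unfolding perp_basis_def using V by (auto intro: someI)
  then show "dim_row ?W = n" by (simp add: orthonormal_basis_of_def)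
  define m where "m = dim_col ?W"
  have Wc: "?W \<in> carrier_mat n m" and W_on: "orthonormal_cols ?W" and W_span: "col_span ?W = ?C"
    using W by (auto simp: orthonormal_basis_of_def m_def)
  assume x: "x \<in> carrier_vec n"
  let ?y = "N *\<^sub>v (N\<^sup>T *\<^sub>v x)"
  \<comment> \<open>The columns of \<open>?W\<close> lie in the complement of the span of
    \<open>V\<close>, so \<open>?W\<^sup>T\<close> annihilates the \<open>V\<close>-part of
    \<open>x\<close>. The remaining part is bounded by Bessel for \<open>?W\<close> and the isometry
    of \<open>N\<close>.\<close>
  have "row ?W\<^sup>T i \<bullet> (V *\<^sub>v (V\<^sup>T *\<^sub>v x)) = 0" if i: "i < m" for i
  proof -
    have "col ?W i \<in> ?C"
      using cols_subset_col_span[OF Wc] W_span Wc i by (auto simp: cols_def)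
    moreover have "V *\<^sub>v (V\<^sup>T *\<^sub>v x) \<in> col_span V"
      using V x by (auto simp: col_span_eq[OF V])
    ultimately show ?thesis
      using i Wc by (simp add: ortho_compl_def vec_module.orthogonal_complement_def)
  qed
  then have "?W\<^sup>T *\<^sub>v (V *\<^sub>v (V\<^sup>T *\<^sub>v x)) = 0\<^sub>v m"
    using Wc by (intro eq_vecI) auto
  then have "?W\<^sup>T *\<^sub>v x = ?W\<^sup>T *\<^sub>v ?y"
    using split[OF x] Wc V N x
      mult_add_distrib_mat_vec[of "?W\<^sup>T" m n "V *\<^sub>v (V\<^sup>T *\<^sub>v x)" ?y] by simp
  also have "euclid_norm \<dots> \<le> euclid_norm ?y"
    using N x by (intro euclid_norm_orthonormal_transpose[OF Wc W_on]) auto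
  also have "\<dots> = euclid_norm (N\<^sup>T *\<^sub>v x)"
    using N x by (intro euclid_norm_orthonormal[OF N N_on]) auto
  finally show "euclid_norm (?W\<^sup>T *\<^sub>v x) \<le> euclid_norm (N\<^sup>T *\<^sub>v x)" .
qed

section \<open>Traces of congruences and the trace ratio\<close>

lemma index_congruence:
  fixes C :: "real mat"
  assumes "X \<in> carrier_mat n a" "C \<in> carrier_mat n n" "Y \<in> carrier_mat n b" "r < a" "c < b"
  shows "(X\<^sup>T * C * Y) $$ (r, c) = col X r \<bullet> (C *\<^sub>v col Y c)"
proof -
  have "X\<^sup>T * C * Y = X\<^sup>T * (C * Y)"
    using assms by (intro assoc_mult_mat) auto
  moreover have "col (C * Y) c = C *\<^sub>v col Y c"
    by (rule col_mult2[OF assms(2,3,5)])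
  ultimately show ?thesis using assms by (simp del: col_mult)
qed

lemma mat_trace_congruence:
  assumes "C \<in> carrier_mat n n" "W \<in> carrier_mat n k"
  shows "mat_trace (W\<^sup>T * C * W) = (\<Sum>i<k. col W i \<bullet> (C *\<^sub>v col W i))"
proof -
  have "dim_row (W\<^sup>T * C * W) = k" using assms by simp
  then show ?thesis unfolding mat_trace_def
    using assms index_congruence[OF assms(2) assms(1) assms(2)] by (auto intro!: sum.cong)
qed

text \<open>This linearises the trace ratio: where the \<open>B\<close>-trace is positive,
  \<open>trace_ratio A B W \<le> r\<close> holds exactly if the trace on the left is at most
  0.\<close>

lemma mat_trace_pencil:
  assumes A: "A \<in> carrier_mat n n" and B: "B \<in> carrier_mat n n" and W: "W \<in> carrier_mat n k"
  shows "mat_trace (W\<^sup>T * (A - r \<cdot>\<^sub>m B) * W)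
           = mat_trace (W\<^sup>T * A * W) - r * mat_trace (W\<^sup>T * B * W)"
proof -
  have "x \<bullet> ((A - r \<cdot>\<^sub>m B) *\<^sub>v x) = x \<bullet> (A *\<^sub>v x) - r * (x \<bullet> (B *\<^sub>v x))"
    if x: "x \<in> carrier_vec n" for x
  proof -
    have "(A - r \<cdot>\<^sub>m B) *\<^sub>v x = A *\<^sub>v x - r \<cdot>\<^sub>v (B *\<^sub>v x)"
      using A B x minus_mult_distrib_mat_vec[OF A, of "r \<cdot>\<^sub>m B" x]
        smult_mat_mult_vec[OF B x] by simp
    then show ?thesis
      using A B x scalar_prod_minus_distrib[of x n "A *\<^sub>v x" "r \<cdot>\<^sub>v (B *\<^sub>v x)"] by simp
  qed
  then show ?thesis
    using mat_trace_congruence[OF A W] mat_trace_congruence[OF B W] W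
      mat_trace_congruence[OF minus_carrier_mat W, of "r \<cdot>\<^sub>m B" A] B
    by (simp add: sum_subtractf sum_distrib_left del: assoc_mult_mat)
qed

text \<open>The denominator of the trace ratio: orthonormal columns are unit vectors, hence nonzero,
  and \<open>0 < k\<close> keeps the sum from being empty.\<close>

lemma mat_trace_pos_def:
  assumes B: "pos_def n B" and W: "W \<in> carrier_mat n k" "orthonormal_cols W" and k: "0 < k"
  shows "0 < mat_trace (W\<^sup>T * B * W)"
proof -
  have "0 < col W i \<bullet> (B *\<^sub>v col W i)" if i: "i < k" for i
  proof -
    have "col W i \<bullet> col W i = 1"
      using W(2) i unfolding orthonormal_cols_iff[OF W(1)] by simp
    then have "col W i \<noteq> 0\<^sub>v n" by auto
    then show ?thesis using B W i by (auto simp: pos_def_def)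
  qed
  then show ?thesis
    using B W k by (auto simp: mat_trace_congruence[of _ n] pos_def_def intro!: sum_pos)
qed

section \<open>First-order optimality\<close>

lemma linear_le_quadratic_imp_zero:
  fixes t D :: real
  assumes "\<And>s. 2 * s * t \<le> s\<^sup>2 * D"
  shows "t = 0"
proof (rule ccontr)
  assume "t \<noteq> 0"
  \<comment> \<open>Near \<open>s = 0\<close> the linear term wins. The value
    \<open>s = ?e * t\<close> is small enough that \<open>?e * D \<le> 1\<close>, and cancelling
    \<open>?e * t\<^sup>2\<close> then leaves \<open>2 \<le> 1\<close>.\<close>
  let ?e = "1 / (1 + \<bar>D\<bar>)"
  have e: "0 < ?e" by simp
  have "?e * t\<^sup>2 * 2 \<le> ?e * t\<^sup>2 * (?e * D)"
    using assms[of "?e * t"] by (simp add: power2_eq_square algebra_simps)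
  moreover have "0 < ?e * t\<^sup>2" using e \<open>t \<noteq> 0\<close> by (intro mult_pos_pos) simp_all
  ultimately have "2 \<le> ?e * D" by (simp only: mult_le_cancel_left_pos)
  moreover have "?e * D \<le> 1" by (simp add: field_simps)
  ultimately show False by linarith
qed

text \<open>Rotating the column \<open>v\<^sub>i\<close> of \<open>V\<close> towards a column \<open>q\<^sub>l\<close> of \<open>Q\<close> stays feasible; the trace is
  then a function of one angle whose derivative at \<open>0\<close> is \<open>2 q\<^sub>l\<^sup>T C v\<^sub>i\<close>.\<close>
lemma trace_maximizer_stationary:
  fixes C V Q :: "real mat"
  assumes C: "C \<in> carrier_mat n n" "C\<^sup>T = C"
    and V: "V \<in> carrier_mat n k" and Q: "Q \<in> carrier_mat n m"
    and U_def: "U = mat_of_cols n (cols V @ cols Q)" and U_on: "orthonormal_cols U"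
    and max: "\<And>W. W \<in> carrier_mat n k \<Longrightarrow> orthonormal_cols W \<Longrightarrow> set (cols W) \<subseteq> col_span U \<Longrightarrow>
               mat_trace (W\<^sup>T * C * W) \<le> mat_trace (V\<^sup>T * C * V)"
  shows "Q\<^sup>T * C * V = 0\<^sub>m m k"
proof (rule eq_matI)
  fix l i assume "l < dim_row (0\<^sub>m m k)" "i < dim_col (0\<^sub>m m k)"
  then have l: "l < m" and i: "i < k" by auto
  note U = hcat_carrier[OF V Q U_def]
  have on: "col U r \<bullet> col U c = (if r = c then 1 else 0)" if "r < k + m" "c < k + m" for r c
    using U_on that unfolding orthonormal_cols_iff[OF U] by blast
  have VV: "col V r \<bullet> col V c = (if r = c then 1 else 0)" if "r < k" "c < k" for r c
    using on[of r c] that by (simp add: hcat_col[OF V Q U_def])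
  have VQ: "col V r \<bullet> col Q c = 0" if "r < k" "c < m" for r c
    using on[of r "k + c"] that by (simp add: hcat_col[OF V Q U_def])
  have QQ: "col Q l \<bullet> col Q l = 1"
    using on[of "k + l" "k + l"] l by (simp add: hcat_col[OF V Q U_def])
  define v q where "v = col V i" and "q = col Q l"
  have v: "v \<in> carrier_vec n" and q: "q \<in> carrier_vec n"
    using V Q i l by (auto simp: v_def q_def)
  have Vc: "col V c \<in> carrier_vec n" if "c < k" for c using V that by auto
  have qv: "q \<bullet> col V c = 0" if "c < k" for c
    using VQ[OF that l] comm_scalar_prod[OF q Vc[OF that]] by (simp add: q_def)
  have U_cols: "set (cols V) \<union> set (cols Q) \<subseteq> col_span U"
    using cols_subset_col_span[OF U] V Q cols_dim[of V] cols_dim[of Q] unfolding U_def by auto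
  have v_U: "v \<in> col_span U" and q_U: "q \<in> col_span U"
    using U_cols V Q i l by (auto simp: v_def q_def cols_def)
  \<comment> \<open>Symmetry of \<open>C\<close> merges the two mixed terms of
    \<open>w \<bullet> (C *\<^sub>v w)\<close> into one.\<close>
  have sym: "v \<bullet> (C *\<^sub>v q) = q \<bullet> (C *\<^sub>v v)"
  proof -
    have "v \<bullet> (C *\<^sub>v q) = (C\<^sup>T *\<^sub>v v) \<bullet> q"
      using transpose_vec_mult_scalar[OF C(1) q v] by simp
    then show ?thesis using C v q by (simp add: comm_scalar_prod[of _ n])
  qed
  \<comment> \<open>Comparing \<open>V\<close> with its rotation bounds a linear term in
    \<open>s\<close> by a quadratic one for both signs of \<open>s\<close>, which forces the linear
    coefficient to vanish.\<close>
  have "2 * s * (q \<bullet> (C *\<^sub>v v)) \<le> s\<^sup>2 * (v \<bullet> (C *\<^sub>v v) - q \<bullet> (C *\<^sub>v q))" for s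
  proof -
    \<comment> \<open>\<open>a\<close> and \<open>b\<close> are the cosine and the sine of the angle
      with tangent \<open>s\<close>; the inequality is then polynomial in \<open>s\<close> after
      division by \<open>a\<^sup>2\<close>.\<close>
    define a b where "a = 1 / sqrt (1 + s\<^sup>2)" and "b = s * a"
    have pos: "0 < 1 + s\<^sup>2" by (simp add: add_pos_nonneg)
    have a2: "a\<^sup>2 * (1 + s\<^sup>2) = 1"
      using pos by (simp add: a_def power_divide)
    have a_pos: "0 < a\<^sup>2" using pos by (simp add: a_def)
    from a2 have ab: "a\<^sup>2 + b\<^sup>2 = 1" by (simp add: b_def power_mult_distrib algebra_simps)
    define w where "w = a \<cdot>\<^sub>v v + b \<cdot>\<^sub>v q"
    have w: "w \<in> carrier_vec n" using v q by (simp add: w_def)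
    define W where "W = mat_of_cols n (map (\<lambda>c. if c = i then w else col V c) [0..<k])"
    have W: "W \<in> carrier_mat n k" unfolding W_def by (intro carrier_matI) auto
    have W_col: "col W c = (if c = i then w else col V c)" if "c < k" for c
      using that w V unfolding W_def by (subst col_mat_of_cols) auto
    have wV: "w \<bullet> col V c = 0" if "c < k" "c \<noteq> i" for c
      using VV[OF i that(1)] qv[OF that(1)] that v q Vc[OF that(1)]
      by (simp add: w_def add_scalar_prod_distrib[of _ n] v_def)
    have Vw: "col V c \<bullet> w = 0" if "c < k" "c \<noteq> i" for c
      using wV[OF that] comm_scalar_prod[OF w Vc[OF that(1)]] by simp
    have vq0: "q \<bullet> v = 0" "v \<bullet> q = 0" using qv[OF i] VQ[OF i l] by (auto simp: v_def q_def)
    have ww: "w \<bullet> w = 1"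
      using ab vq0 VV[OF i i] QQ v q
      by (simp add: w_def add_scalar_prod_distrib[of _ n] scalar_prod_add_distrib[of _ n]
          power2_eq_square flip: v_def q_def)
    have "orthonormal_cols W"
      unfolding orthonormal_cols_iff[OF W] using wV Vw ww VV by (auto simp: W_col)
    moreover have "w \<in> col_span U"
      unfolding w_def by (rule col_span_combination[OF U v_U q_U])
    then have "set (cols W) \<subseteq> col_span U"
      using U_cols W V by (auto simp: cols_def W_col)
    ultimately have "mat_trace (W\<^sup>T * C * W) \<le> mat_trace (V\<^sup>T * C * V)"
      using W by (intro max)
    \<comment> \<open>\<open>V\<close> and \<open>W\<close> differ in column \<open>i\<close> only,
      so the other summands of the two traces cancel.\<close>
    moreover have "(\<Sum>c\<in>{..<k} - {i}. col W c \<bullet> (C *\<^sub>v col W c))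
                 = (\<Sum>c\<in>{..<k} - {i}. col V c \<bullet> (C *\<^sub>v col V c))"
      by (rule sum.cong) (auto simp: W_col)
    ultimately have "w \<bullet> (C *\<^sub>v w) \<le> v \<bullet> (C *\<^sub>v v)"
      using i by (simp add: mat_trace_congruence[OF C(1) W] mat_trace_congruence[OF C(1) V]
          sum.remove[of "{..<k}" i] W_col flip: v_def)
    moreover have "C *\<^sub>v w = a \<cdot>\<^sub>v (C *\<^sub>v v) + b \<cdot>\<^sub>v (C *\<^sub>v q)"
      using C v q mult_add_distrib_mat_vec[OF C(1), of "a \<cdot>\<^sub>v v" "b \<cdot>\<^sub>v q"]
      by (simp add: w_def mult_mat_vec[OF C(1)])
    then have "w \<bullet> (C *\<^sub>v w) = a\<^sup>2 * (v \<bullet> (C *\<^sub>v v)) + 2 * a * b * (q \<bullet> (C *\<^sub>v v)) + b\<^sup>2 * (q \<bullet> (C *\<^sub>v q))"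
      using C v q sym
      by (simp add: w_def add_scalar_prod_distrib[of _ n] scalar_prod_add_distrib[of _ n]
          power2_eq_square algebra_simps)
    \<comment> \<open>The factor \<open>a\<^sup>2 * (1 + s\<^sup>2)\<close>, which equals 1, is put
      on the right so that \<open>a\<^sup>2\<close> becomes common to both sides.\<close>
    ultimately have "a\<^sup>2 * (v \<bullet> (C *\<^sub>v v) + 2 * s * (q \<bullet> (C *\<^sub>v v)) + s\<^sup>2 * (q \<bullet> (C *\<^sub>v q)))
        \<le> a\<^sup>2 * (1 + s\<^sup>2) * (v \<bullet> (C *\<^sub>v v))"
      unfolding a2 by (simp add: b_def power2_eq_square algebra_simps)
    then have "v \<bullet> (C *\<^sub>v v) + 2 * s * (q \<bullet> (C *\<^sub>v v)) + s\<^sup>2 * (q \<bullet> (C *\<^sub>v q))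
        \<le> (1 + s\<^sup>2) * (v \<bullet> (C *\<^sub>v v))"
      using a_pos by (simp only: mult.assoc mult_le_cancel_left_pos)
    then show ?thesis by (simp add: algebra_simps)
  qed
  then have "q \<bullet> (C *\<^sub>v v) = 0" by (rule linear_le_quadratic_imp_zero)
  then show "(Q\<^sup>T * C * V) $$ (l, i) = 0\<^sub>m m k $$ (l, i)"
    using index_congruence[OF Q C(1) V l i] l i by (simp add: v_def q_def)
qed (use V Q in auto)

section \<open>The bound for the solution projected onto \<U>\<close>

theorem proposition8:
  fixes p k j :: nat
    and A B Vstar \<Lambda> V Q Uperp U M :: "real mat"
    and \<U> :: "real vec set"
    and \<rho>star \<rho> sin\<theta> \<eta> :: real
  assumes "A \<in> carrier_mat p p" and "A\<^sup>T = A"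
    and "pos_def p B"
    and "1 \<le> k" and "k < p"
    and "trace_ratio_solution p k A B Vstar \<rho>star"
    and "\<Lambda> \<in> carrier_mat k k"
    and "(A - \<rho>star \<cdot>\<^sub>m B) * Vstar = Vstar * \<Lambda>"
    and "eigenvalue_desc k (A - \<rho>star \<cdot>\<^sub>m B) > eigenvalue_desc (k + 1) (A - \<rho>star \<cdot>\<^sub>m B)"
    and "k < j" and "j \<le> p"
    and "subspace_of_dim p j \<U>"
    and "projected_trace_ratio_solution p k A B \<U> V \<rho>"
    and "Q \<in> carrier_mat p (j - k)"
    and "Uperp \<in> carrier_mat p (p - j)"
    and "orthonormal_cols (mat_of_cols p (cols V @ cols Q @ cols Uperp))"
    and "U = mat_of_cols p (cols V @ cols Q)"
    and "orthonormal_basis_of p \<U> U"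
    and "col_span Uperp = ortho_compl p \<U>"
    and "sin\<theta> = spectral_norm (Uperp\<^sup>T * Vstar)"
    and "\<eta> = spectral_norm (U\<^sup>T * (A - \<rho>star \<cdot>\<^sub>m B) * Uperp)"
    and "M = Q\<^sup>T * (A - \<rho> \<cdot>\<^sub>m B) * Q"
    and "sep \<Lambda> M > 0"
  shows "(sin_between V Vstar)\<^sup>2
    \<le> sin\<theta>\<^sup>2
      + ((\<eta> * sin\<theta> + (\<rho>star - \<rho>) * spectral_norm B * (1 + sin\<theta>)) / sep \<Lambda> M)\<^sup>2"
proof -
  \<comment> \<open>\<open>C\<close> and \<open>Cs\<close> are the pencils at the projected ratio
    and at the true ratio; they differ by \<delta> times \<open>B\<close>.\<close>
  define C where "C = A - \<rho> \<cdot>\<^sub>m B"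
  define Cs where "Cs = A - \<rho>star \<cdot>\<^sub>m B"
  define \<delta> where "\<delta> = \<rho>star - \<rho>"
  define m where "m = j - k"
  note A = assms(1,2)
  have B: "B \<in> carrier_mat p p" "B\<^sup>T = B" using assms(3) by (auto simp: pos_def_def)
  have C: "C \<in> carrier_mat p p" and Cs: "Cs \<in> carrier_mat p p"
    using A B by (auto simp: C_def Cs_def)
  have Vs: "Vstar \<in> carrier_mat p k" "orthonormal_cols Vstar"
    using assms(6) by (auto simp: trace_ratio_solution_def Let_def)
  have V: "V \<in> carrier_mat p k" and V_on: "orthonormal_cols V" and \<rho>: "\<rho> = trace_ratio A B V"
    and V_max: "\<And>W. W \<in> carrier_mat p k \<Longrightarrow> orthonormal_cols W \<Longrightarrow> set (cols W) \<subseteq> \<U> \<Longrightarrow>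
                  trace_ratio A B W \<le> \<rho>"
    using assms(13) by (auto simp: projected_trace_ratio_solution_def Let_def)
  \<comment> \<open>\<open>V\<close> is also feasible in the unprojected problem, where its ratio
    \<rho> cannot exceed the maximum.\<close>
  have \<delta>: "0 \<le> \<delta>"
    using assms(6) V V_on \<rho> by (auto simp: trace_ratio_solution_def Let_def \<delta>_def)
  have Q: "Q \<in> carrier_mat p m" using assms(14) by (simp add: m_def)
  note Up = assms(15) and \<Lambda> = assms(7) and U_def = assms(17)
  have U: "U \<in> carrier_mat p j"
    using hcat_carrier[OF V Q U_def] assms(10) by (simp add: m_def)
  have U_on: "orthonormal_cols U" and U_span: "col_span U = \<U>"
    using assms(18) by (auto simp: orthonormal_basis_of_def)
  \<comment> \<open>\<open>X\<close> is the given orthogonal matrix; it is grouped below both as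
    \<open>[V N]\<close> and as \<open>[U Uperp]\<close>.\<close>
  define X where "X = mat_of_cols p (cols V @ cols Q @ cols Uperp)"
  define N where "N = mat_of_cols p (cols Q @ cols Uperp)"
  have N: "N \<in> carrier_mat p (p - k)"
    using hcat_carrier[OF Q Up N_def] assms(10,11) by (simp add: m_def)
  have cols_carrier: "set (cols V) \<subseteq> carrier_vec p" "set (cols Q) \<subseteq> carrier_vec p"
      "set (cols Uperp) \<subseteq> carrier_vec p"
    using V Q Up cols_dim by blast+
  have X_VN: "X = mat_of_cols p (cols V @ cols N)" and X_UU: "X = mat_of_cols p (cols U @ cols Uperp)"
    using cols_carrier by (simp_all add: X_def N_def U_def)
  have X: "X \<in> carrier_mat p p" using hcat_carrier[OF V N X_VN] assms(5) by simp
  have X_on: "orthonormal_cols X" using assms(16) by (simp add: X_def)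
  \<comment> \<open>\<open>X\<close> is square, so its left inverse \<open>X\<^sup>T\<close> is also
    a right inverse.\<close>
  have "X * X\<^sup>T = 1\<^sub>m p"
    using mat_mult_left_right_inverse[of "X\<^sup>T" p X] X X_on by (simp add: orthonormal_cols_def)
  then have res_VN: "V * V\<^sup>T + N * N\<^sup>T = 1\<^sub>m p" and res_U: "U * U\<^sup>T + Uperp * Uperp\<^sup>T = 1\<^sub>m p"
    using hcat_mult_transpose[OF V N X_VN] hcat_mult_transpose[OF U Up X_UU] by simp_all

  \<comment> \<open>Optimality of \<open>V\<close> for the pencil \<open>C\<close>\<close>
  have trace_pos: "0 < mat_trace (W\<^sup>T * B * W)" if "W \<in> carrier_mat p k" "orthonormal_cols W" for W
    using mat_trace_pos_def[OF assms(3) that] assms(4) by simp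
  \<comment> \<open>Dinkelbach's reformulation: the trace for \<open>C\<close> is 0 at
    \<open>V\<close> and at most 0 at every feasible \<open>W\<close> in \<U>. Thus \<open>V\<close>
    maximises a trace, and the stationarity lemma applies.\<close>
  have "mat_trace (V\<^sup>T * C * V) = 0"
    using trace_pos[OF V V_on] \<rho>
    by (simp add: C_def mat_trace_pencil[OF A(1) B(1) V] trace_ratio_def)
  moreover have "mat_trace (W\<^sup>T * C * W) \<le> 0"
    if "W \<in> carrier_mat p k" "orthonormal_cols W" "set (cols W) \<subseteq> \<U>" for W
    using trace_pos[OF that(1,2)] V_max[OF that]
    by (simp add: C_def mat_trace_pencil[OF A(1) B(1) that(1)] trace_ratio_def field_simps)
  moreover have "C\<^sup>T = C"
    using A B by (auto simp: C_def transpose_minus[of _ p p] intro!: eq_matI)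
       (metis carrier_matD index_transpose_mat(1))+
  ultimately have QCV: "Q\<^sup>T * C * V = 0\<^sub>m m k"
    using trace_maximizer_stationary[OF C _ V Q U_def U_on] U_span by simp

  \<comment> \<open>The residual equation\<close>
  define P where "P = Q\<^sup>T * Vstar"
  define G where "G = Uperp\<^sup>T * Vstar"
  \<comment> \<open>\<open>Y\<close> is the orthogonal projection of \<open>Vstar\<close> onto
    \<U>.\<close>
  define Y where "Y = U * (U\<^sup>T * Vstar)"
  have P: "P \<in> carrier_mat m k" and G: "G \<in> carrier_mat (p - j) k" and Y: "Y \<in> carrier_mat p k"
    using Q Up U Vs by (auto simp: P_def G_def Y_def)
  have M: "M \<in> carrier_mat m m" using assms(22) Q C by (simp add: C_def)
  have Qt: "Q\<^sup>T \<in> carrier_mat m p" using Q by simp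
  have Vs_split: "Vstar = Y + Uperp * G"
  proof -
    have "Vstar = (U * U\<^sup>T + Uperp * Uperp\<^sup>T) * Vstar" using Vs by (simp add: res_U)
    also have "\<dots> = U * U\<^sup>T * Vstar + Uperp * Uperp\<^sup>T * Vstar"
      using U Up Vs by (intro add_mult_distrib_mat) auto
    also have "\<dots> = Y + Uperp * G"
      using U Up Vs unfolding Y_def G_def by (simp add: assoc_mult_mat[of _ p _ _ p _ k])
    finally show ?thesis .
  qed
  have Y_split: "Y = V * (V\<^sup>T * Vstar) + Q * P"
  proof -
    have "Y = (U * U\<^sup>T) * Vstar" using U Vs by (simp add: Y_def)
    also have "\<dots> = (V * V\<^sup>T + Q * Q\<^sup>T) * Vstar"
      using hcat_mult_transpose[OF V Q U_def] by simp
    also have "\<dots> = V * V\<^sup>T * Vstar + Q * Q\<^sup>T * Vstar"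
      using V Q Vs by (intro add_mult_distrib_mat) auto
    finally show ?thesis using V Q Vs unfolding P_def by simp
  qed
  \<comment> \<open>Of the two components of \<open>Y\<close>, the one along \<open>V\<close> is
    annihilated by \<open>QCV\<close>, and the one along \<open>Q\<close> gives
    \<open>M * P\<close>.\<close>
  have QCY: "Q\<^sup>T * (C * Y) = M * P"
  proof -
    have "Q\<^sup>T * (C * Y) = (Q\<^sup>T * C) * Y" using Qt C Y by simp
    also have "\<dots> = (Q\<^sup>T * C) * (V * (V\<^sup>T * Vstar)) + (Q\<^sup>T * C) * (Q * P)"
      unfolding Y_split using Qt C V Q Vs P by (intro mult_add_distrib_mat) auto
    also have "(Q\<^sup>T * C) * (V * (V\<^sup>T * Vstar)) = (Q\<^sup>T * C * V) * (V\<^sup>T * Vstar)"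
      using Qt C V Vs by (intro assoc_mult_mat[symmetric]) auto
    also have "\<dots> = 0\<^sub>m m k" unfolding QCV using V Vs by (intro left_mult_zero_mat) auto
    also have "(Q\<^sup>T * C) * (Q * P) = (Q\<^sup>T * C * Q) * P"
      using Qt C Q P by (intro assoc_mult_mat[symmetric]) auto
    also have "\<dots> = M * P" by (simp add: assms(22) C_def)
    finally show ?thesis using M P by simp
  qed
  define R1 where "R1 = (Q\<^sup>T * Cs * Uperp) * G"
  define R2 where "R2 = Q\<^sup>T * (B * Y)"
  have R1: "R1 \<in> carrier_mat m k" and R2: "R2 \<in> carrier_mat m k"
    using Qt Cs Up G B Y by (auto simp: R1_def R2_def)
  have "P * \<Lambda> = M * P + (- \<delta>) \<cdot>\<^sub>m R2 + R1"
  proof -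
    \<comment> \<open>Only the part in \<U> is passed from \<open>Cs\<close> to \<open>C\<close>,
      where stationarity is available. The part along \<open>Uperp\<close> keeps \<open>Cs\<close>,
      with which \<eta> is defined.\<close>
    have CsY: "Cs * Y = C * Y + (- \<delta>) \<cdot>\<^sub>m (B * Y)"
    proof -
      have "Cs = C + (- \<delta>) \<cdot>\<^sub>m B"
        using A B by (intro eq_matI) (auto simp: C_def Cs_def \<delta>_def algebra_simps)
      then have "Cs * Y = C * Y + ((- \<delta>) \<cdot>\<^sub>m B) * Y"
        using add_mult_distrib_mat[OF C, of "(- \<delta>) \<cdot>\<^sub>m B" Y] B Y by simp
      then show ?thesis using mult_smult_assoc_mat[OF B(1) Y] by simp
    qed
    have "P * \<Lambda> = Q\<^sup>T * (Cs * Vstar)"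
      using Qt Vs \<Lambda> assms(8) by (simp add: P_def Cs_def)
    also have "Cs * Vstar = Cs * Y + Cs * (Uperp * G)"
      using Cs Y Up G by (subst Vs_split) (intro mult_add_distrib_mat, auto)
    also have "Q\<^sup>T * \<dots> = Q\<^sup>T * (Cs * Y) + Q\<^sup>T * (Cs * (Uperp * G))"
      using Qt Cs Y Up G by (intro mult_add_distrib_mat) auto
    also have "Q\<^sup>T * (Cs * Y) = Q\<^sup>T * (C * Y) + Q\<^sup>T * ((- \<delta>) \<cdot>\<^sub>m (B * Y))"
      unfolding CsY using Qt C B Y by (intro mult_add_distrib_mat) auto
    also have "Q\<^sup>T * ((- \<delta>) \<cdot>\<^sub>m (B * Y)) = (- \<delta>) \<cdot>\<^sub>m R2"
      unfolding R2_def using Qt B Y by (intro mult_smult_distrib) auto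
    also have "Q\<^sup>T * (Cs * (Uperp * G)) = R1"
    proof -
      have "R1 = (Q\<^sup>T * Cs) * (Uperp * G)"
        unfolding R1_def using Qt Cs Up G by (intro assoc_mult_mat) auto
      also have "\<dots> = Q\<^sup>T * (Cs * (Uperp * G))"
        using Qt Cs Up G by (intro assoc_mult_mat) auto
      finally show ?thesis by simp
    qed
    finally show ?thesis unfolding QCY .
  qed
  then have residual: "P * \<Lambda> - M * P = R1 + (- \<delta>) \<cdot>\<^sub>m R2"
    using P \<Lambda> M R1 R2 by (intro eq_matI) auto

  \<comment> \<open>Norms of the residual terms\<close>
  have "spectral_norm (Q\<^sup>T * Cs * Uperp) \<le> \<eta>"
  proof (rule spectral_norm_leI)
    fix x :: "real vec" assume "x \<in> carrier_vec (dim_col (Q\<^sup>T * Cs * Uperp))"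
    then have x: "x \<in> carrier_vec (p - j)" using Up by simp
    have assoc: "(S\<^sup>T * Cs * Uperp) *\<^sub>v x = S\<^sup>T *\<^sub>v (Cs *\<^sub>v (Uperp *\<^sub>v x))"
      if "S \<in> carrier_mat p a" for S a
    proof -
      have "(S\<^sup>T * Cs * Uperp) *\<^sub>v x = (S\<^sup>T * Cs) *\<^sub>v (Uperp *\<^sub>v x)"
        using that Cs Up x by (intro assoc_mult_mat_vec) auto
      also have "\<dots> = S\<^sup>T *\<^sub>v (Cs *\<^sub>v (Uperp *\<^sub>v x))"
        using that Cs Up x by (intro assoc_mult_mat_vec) auto
      finally show ?thesis .
    qed
    \<comment> \<open>Since \<open>U = [V Q]\<close>, passing from \<open>U\<^sup>T\<close> to
      \<open>Q\<^sup>T\<close> drops the entries that belong to \<open>V\<close>, which cannot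
      increase the norm.\<close>
    have "(euclid_norm ((Q\<^sup>T * Cs * Uperp) *\<^sub>v x))\<^sup>2 \<le> (euclid_norm ((U\<^sup>T * Cs * Uperp) *\<^sub>v x))\<^sup>2"
      unfolding assoc[OF Q] assoc[OF U] by (simp add: hcat_transpose_norm[OF V Q U_def])
    then have "euclid_norm ((Q\<^sup>T * Cs * Uperp) *\<^sub>v x) \<le> euclid_norm ((U\<^sup>T * Cs * Uperp) *\<^sub>v x)"
      by (rule power2_le_imp_le) simp
    also have "\<dots> \<le> \<eta> * euclid_norm x"
      unfolding assms(21) Cs_def[symmetric] using U Cs Up x by (intro euclid_norm_mult_mat_vec) auto
    finally show "euclid_norm ((Q\<^sup>T * Cs * Uperp) *\<^sub>v x) \<le> \<eta> * euclid_norm x" .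
  qed (simp add: assms(21))
  moreover have "spectral_norm R1 \<le> spectral_norm (Q\<^sup>T * Cs * Uperp) * sin\<theta>"
    unfolding R1_def assms(20) G_def[symmetric] using Qt Cs Up G by (intro spectral_norm_mult) auto
  ultimately have R1_le: "spectral_norm R1 \<le> \<eta> * sin\<theta>"
    using mult_right_mono[of "spectral_norm (Q\<^sup>T * Cs * Uperp)" \<eta> sin\<theta>] by (simp add: assms(20))
  \<comment> \<open>\<open>Y\<close> is the product of \<open>U\<close>, \<open>U\<^sup>T\<close>
    and \<open>Vstar\<close>, each of norm at most 1; with \<open>Q\<^sup>T\<close> also of norm at
    most 1, only the norm of \<open>B\<close> remains in the bound for \<open>R2\<close>.\<close>
  have "spectral_norm (U\<^sup>T * Vstar) \<le> spectral_norm U\<^sup>T * spectral_norm Vstar"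
    using U Vs by (intro spectral_norm_mult) auto
  also have "\<dots> \<le> 1 * 1"
    using spectral_norm_orthonormal_le[OF U U_on] spectral_norm_orthonormal_le[OF Vs]
    by (intro mult_mono) auto
  finally have "spectral_norm U * spectral_norm (U\<^sup>T * Vstar) \<le> 1 * 1"
    using spectral_norm_orthonormal_le[OF U U_on] by (intro mult_mono) auto
  moreover have "spectral_norm Y \<le> spectral_norm U * spectral_norm (U\<^sup>T * Vstar)"
    unfolding Y_def using U Vs by (intro spectral_norm_mult) auto
  ultimately have "spectral_norm B * spectral_norm Y \<le> spectral_norm B * 1"
    by (intro mult_left_mono) auto
  moreover have "spectral_norm (B * Y) \<le> spectral_norm B * spectral_norm Y"
    using B Y by (intro spectral_norm_mult) auto
  ultimately have "spectral_norm Q\<^sup>T * spectral_norm (B * Y) \<le> 1 * spectral_norm B"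
    using spectral_norm_orthonormal_le[OF Q hcat_orthonormal(2)[OF V Q U_def U_on]]
    by (intro mult_mono) auto
  moreover have "spectral_norm R2 \<le> spectral_norm Q\<^sup>T * spectral_norm (B * Y)"
    unfolding R2_def using Qt B Y by (intro spectral_norm_mult) auto
  ultimately have R2_le: "spectral_norm R2 \<le> spectral_norm B" by simp

  \<comment> \<open>Bound for the norm of \<open>P\<close>\<close>
  let ?K = "\<eta> * sin\<theta> + \<delta> * spectral_norm B * (1 + sin\<theta>)"
  have sin_nonneg: "0 \<le> sin\<theta>" by (simp add: assms(20))
  have "sep \<Lambda> M * spectral_norm P \<le> spectral_norm (P * \<Lambda> - M * P)"
    by (rule sep_mult_le[OF \<Lambda> M P])
  also have "\<dots> \<le> spectral_norm R1 + \<delta> * spectral_norm R2"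
    unfolding residual using spectral_norm_add[OF R1, of "(- \<delta>) \<cdot>\<^sub>m R2"] R2 \<delta>
    by (simp add: spectral_norm_smult)
  also have "\<dots> \<le> \<eta> * sin\<theta> + \<delta> * spectral_norm B"
    using R1_le mult_left_mono[OF R2_le \<delta>] by simp
  \<comment> \<open>The factor \<open>1 + sin\<theta>\<close> of the claim enters here, as a number
    that is at least 1.\<close>
  also have "\<dots> \<le> ?K"
    using \<delta> sin_nonneg by (simp add: distrib_left)
  finally have "spectral_norm P \<le> ?K / sep \<Lambda> M"
    using assms(23) by (simp add: field_simps)
  then have P_le: "(spectral_norm P)\<^sup>2 \<le> (?K / sep \<Lambda> M)\<^sup>2"
    by (intro power_mono) auto

  \<comment> \<open>From \<open>P\<close> and \<open>sin\<theta>\<close> to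
    \<open>sin_between V Vstar\<close>\<close>
  let ?W = "perp_basis V"
  have VN: "orthonormal_cols N" "V\<^sup>T * N = 0\<^sub>m k (p - k)"
    using hcat_orthonormal[OF V N X_VN X_on] by auto
  note perp = perp_basis_norm_le[OF V N res_VN VN]
  have W: "?W\<^sup>T \<in> carrier_mat (dim_col ?W) p"
    using perp(1) by (intro carrier_matI) auto
  \<comment> \<open>As \<open>N = [Q Uperp]\<close>, the squared norm of \<open>N\<^sup>T\<close>
    applied to \<open>Vstar *\<^sub>v x\<close> is the sum of those of \<open>P *\<^sub>v x\<close>
    and \<open>G *\<^sub>v x\<close>, and \<open>G\<close> has norm \<open>sin\<theta>\<close>;
    hence this \<open>c\<close>.\<close>
  define c where "c = sqrt ((spectral_norm P)\<^sup>2 + sin\<theta>\<^sup>2)"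
  have "spectral_norm (?W\<^sup>T * Vstar) \<le> c"
  proof (rule spectral_norm_leI)
    fix x :: "real vec" assume "x \<in> carrier_vec (dim_col (?W\<^sup>T * Vstar))"
    then have x: "x \<in> carrier_vec k" using Vs by simp
    have y: "Vstar *\<^sub>v x \<in> carrier_vec p" using Vs x by simp
    have "euclid_norm ((?W\<^sup>T * Vstar) *\<^sub>v x) = euclid_norm (?W\<^sup>T *\<^sub>v (Vstar *\<^sub>v x))"
      using W Vs x by simp
    also have "\<dots> \<le> euclid_norm (N\<^sup>T *\<^sub>v (Vstar *\<^sub>v x))" by (rule perp(2)[OF y])
    also have "\<dots> \<le> c * euclid_norm x"
    proof (rule power2_le_imp_le)
      have "(euclid_norm (N\<^sup>T *\<^sub>v (Vstar *\<^sub>v x)))\<^sup>2 = (euclid_norm (P *\<^sub>v x))\<^sup>2 + (euclid_norm (G *\<^sub>v x))\<^sup>2"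
        using Q Up Vs x by (simp add: hcat_transpose_norm[OF Q Up N_def] P_def G_def)
      also have "\<dots> \<le> (spectral_norm P * euclid_norm x)\<^sup>2 + (sin\<theta> * euclid_norm x)\<^sup>2"
        using euclid_norm_mult_mat_vec[OF P x] euclid_norm_mult_mat_vec[OF G x]
        by (intro add_mono power_mono) (auto simp: assms(20) G_def)
      also have "\<dots> = (c * euclid_norm x)\<^sup>2"
        by (simp add: c_def power_mult_distrib distrib_right)
      finally show "(euclid_norm (N\<^sup>T *\<^sub>v (Vstar *\<^sub>v x)))\<^sup>2 \<le> (c * euclid_norm x)\<^sup>2" .
    qed (simp add: c_def)
    finally show "euclid_norm ((?W\<^sup>T * Vstar) *\<^sub>v x) \<le> c * euclid_norm x" .
  qed (simp add: c_def)
  then have "(sin_between V Vstar)\<^sup>2 \<le> c\<^sup>2"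
    unfolding sin_between_def by (intro power_mono) auto
  then show ?thesis using P_le by (simp add: c_def \<delta>_def)
qed

end
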